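(* Let $G$ be a finite abelian group of order $n$ (identity $e$) such that the generalized dihedral group $D(G)$ is non-abelian, let $r\ge0$ satisfy $2^r=|\{g\in G:g^2=e\}|$, let $\Gamma=\mathfrak{C}(D(G),D(G))$, and let $\Omega_1=\{(g,1):g^2=e\}$, $\Omega_2=\{(g,1):g\in G\}\setminus\Omega_1$, $\Omega_3=\{(g,-1):g\in G\}$. Then for each $v\in\Omega_1$, \[ecc_D(v)=\begin{cases}2n-1 & \text{if } \frac{n}{2^r}<2^r,\\ n+2^r(2^r-1)-1 & \text{if } \frac{n}{2^r}\ge 2^r,\end{cases}\] and for each $v\in\Omega_2\cup\Omega_3$, \[ecc_D(v)=\begin{cases}2n-1 & \text{if } \frac{n}{2^r}\le 2^r,\\ n+4^r-1 & \text{if } \frac{n}{2^r}> 2^r.\end{cases}\]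
   Context: $D(G)=G\rtimes C_2$, $C_2=\{1,-1\}$, has elements $(g,c)$ with multiplication $(g_1,c_1)(g_2,c_2)=(g_1g_2^{c_1},c_1c_2)$. The commuting graph $\mathfrak{C}(D(G),D(G))$ is the simple graph with vertex set $D(G)$ in which distinct $u,v$ are adjacent iff $uv=vu$. The detour distance $d_D(u,v)$ is the length (number of edges) of a longest $u$–$v$ path; the detour eccentricity $ecc_D(v)$ is $\max_{u} d_D(v,u)$ over vertices $u$ of the graph. *)

theory Defs
  imports "HOL-Algebra.Coset" "Graph_Theory.Graph_Theory"
begin

text \<open>The factor \<open>C\<^sub>2\<close> is rendered as the integers \<open>{1, -1}\<close> under multiplication, so that the
  action of \<open>c\<close> on \<open>g\<close> is literally the integer power \<open>g [^] c\<close>.\<close>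

definition gen_dihedral :: "('a, 'm) monoid_scheme \<Rightarrow> ('a \<times> int) monoid" where
  "gen_dihedral G =
    \<lparr> carrier = carrier G \<times> {1, -1},
      monoid.mult = (\<lambda>(g\<^sub>1, c\<^sub>1) (g\<^sub>2, c\<^sub>2). (g\<^sub>1 \<otimes>\<^bsub>G\<^esub> (g\<^sub>2 [^]\<^bsub>G\<^esub> c\<^sub>1), c\<^sub>1 * c\<^sub>2)),
      one = (\<one>\<^bsub>G\<^esub>, 1) \<rparr>"

lemma group_gen_dihedral:
  assumes "comm_group G"
  shows "group (gen_dihedral G)"
proof -
  interpret comm_group G by fact
  show ?thesis
  proof (rule groupI)
    fix x assume "x \<in> carrier (gen_dihedral G)"
    then obtain g c where x: "x = (g, c)" "g \<in> carrier G" "c = 1 \<or> c = -1"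
      by (auto simp: gen_dihedral_def)
    then show "\<exists>y\<in>carrier (gen_dihedral G). y \<otimes>\<^bsub>gen_dihedral G\<^esub> x = \<one>\<^bsub>gen_dihedral G\<^esub>"
      by (intro bexI[of _ "(if c = 1 then inv\<^bsub>G\<^esub> g else g, c)"])
        (auto simp: gen_dihedral_def int_pow_neg)
  qed (auto simp: gen_dihedral_def int_pow_neg int_pow_mult m_assoc inv_mult)
qed

text \<open>The simple graph \<open>\<CC>(H, X)\<close> on the vertex set \<open>X\<close>. Simple graphs are represented, as usual
  in the graph library, by loop-free symmetric digraphs (\<open>pair_graph\<close>).\<close>

definition commuting_graph :: "('a, 'm) monoid_scheme \<Rightarrow> 'a set \<Rightarrow> 'a pair_pre_digraph" where
  "commuting_graph H X =
    \<lparr> pverts = X,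
      parcs = {(u, v). u \<in> X \<and> v \<in> X \<and> u \<noteq> v \<and> u \<otimes>\<^bsub>H\<^esub> v = v \<otimes>\<^bsub>H\<^esub> u} \<rparr>"

lemma pair_graph_commuting_graph:
  assumes "finite X"
  shows "pair_graph (commuting_graph H X)"
proof
  show "finite (parcs (commuting_graph H X))"
    by (rule finite_subset[of _ "X \<times> X"]) (auto simp: commuting_graph_def assms)
  show "symmetric (with_proj (commuting_graph H X))"
    by (auto simp: commuting_graph_def symmetric_def sym_def)
qed (auto simp: commuting_graph_def assms)

text \<open>The sets of which a maximum is taken below are finite for finite graphs, and the first one
  is nonempty if \<open>u\<close> and \<open>v\<close> are joined by a path; \<open>Max\<close> is unspecified otherwise.\<close>

definition detour_dist :: "('a, 'b) pre_digraph \<Rightarrow> 'a \<Rightarrow> 'a \<Rightarrow> nat" where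
  "detour_dist \<Gamma> u v = Max {vwalk_length p | p. vpath p \<Gamma> \<and> hd p = u \<and> last p = v}"

definition detour_ecc :: "('a, 'b) pre_digraph \<Rightarrow> 'a \<Rightarrow> nat" where
  "detour_ecc \<Gamma> v = Max {detour_dist \<Gamma> v u | u. u \<in> verts \<Gamma>}"

end

theory Submission
  imports Defs
begin

text \<open>The center \<open>\<Omega>\<^sub>1\<close> is joined to every vertex, and off the center the commuting graph is a disjoint
  union of cliques: \<open>\<Omega>\<^sub>2\<close>, and the fibres of squaring in \<open>\<Omega>\<^sub>3\<close>, since \<open>(g, -1)\<close> and \<open>(h, -1)\<close>
  commute iff \<open>g\<^sup>2 = h\<^sup>2\<close>. A path can change cliques only by passing through a central vertex, so the
  number of cliques it meets exceeds the number of central vertices on it by at most one (and not at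
  all if it starts at the center). A longest path uses all central vertices and greedily
  sweeps out whole cliques, among them \<open>\<Omega>\<^sub>2\<close>, which is at least as large as the others.\<close>

section \<open>Longest paths in a join of a clique with disjoint cliques\<close>

text \<open>The cliques off the center \<open>C\<close> are encoded as the fibres of
  \<open>f\<close> on \<open>V - C\<close>. One label \<open>a\<close> is singled out because its
  clique may be larger than the others, which all have \<open>t\<close> vertices.\<close>

locale clique_join =
  fixes V C :: "'v set" and f :: "'v \<Rightarrow> 'l" and a :: 'l and t :: nat
  assumes finite_V: "finite V"
    and C_subset: "C \<subseteq> V"
    and C_nonempty: "C \<noteq> {}"
    and a_label: "a \<in> f ` (V - C)"
    and card_other: "b \<in> f ` (V - C) \<Longrightarrow> b \<noteq> a \<Longrightarrow> card {x \<in> V - C. f x = b} = t"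
    and card_large: "t \<le> card {x \<in> V - C. f x = a}"
begin

text \<open>Reflexive, unlike adjacency in a simple graph; \<open>distinct\<close> in
  \<open>path\<close> makes the difference vanish.\<close>

definition adj :: "'v \<Rightarrow> 'v \<Rightarrow> bool" where
  "adj x y \<longleftrightarrow> x \<in> C \<or> y \<in> C \<or> f x = f y"

definition path :: "'v list \<Rightarrow> bool" where
  "path p \<longleftrightarrow> p \<noteq> [] \<and> set p \<subseteq> V \<and> distinct p \<and> successively adj p"

abbreviation labels :: "'l set" where
  "labels \<equiv> f ` (V - C)"

definition block :: "'l \<Rightarrow> 'v set" where
  "block b = {x \<in> V - C. f x = b}"

text \<open>The number of vertices on a longest path from \<open>v\<close>. Besides block
  \<open>a\<close> it meets at most \<open>card labels - 1\<close> blocks, and each costs one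
  central vertex; a central start leaves one fewer to spend.\<close>

definition max_size :: "'v \<Rightarrow> nat" where
  "max_size v =
    card C + card (block a) + t * min (card labels - 1) (card C - (if v \<in> C then 1 else 0))"

lemma finite_C: "finite C"
  using finite_V C_subset finite_subset by blast

lemma card_C_pos: "0 < card C"
  using finite_C C_nonempty by (simp add: card_gt_0_iff)

lemma finite_block: "finite (block b)"
  by (simp add: block_def finite_V)

lemma finite_labels: "finite labels"
  by (simp add: finite_V)

section \<open>Sizes of unions of blocks\<close>

lemma card_blocks:
  assumes "K \<subseteq> labels"
  shows "card (\<Union>b\<in>K. block b) = (if a \<in> K then card (block a) + (card K - 1) * t else card K * t)"
proof -
  have fin: "finite K"
    using assms finite_labels finite_subset by blast
  have "card (\<Union>b\<in>K. block b) = (\<Sum>b\<in>K. card (block b))"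
    by (rule card_UN_disjoint) (auto simp: fin finite_block, auto simp: block_def)
  also have "\<dots> = (if a \<in> K then card (block a) else 0) + (\<Sum>b\<in>K - {a}. card (block b))"
    by (auto simp: fin sum.remove[of K a])
  also have "(\<Sum>b\<in>K - {a}. card (block b)) = (\<Sum>b\<in>K - {a}. t)"
    using assms card_other by (intro sum.cong) (auto simp: block_def)
  finally show ?thesis
    using fin by simp
qed

text \<open>Once \<open>card V\<close> is known from elsewhere, this determines the number of
  cliques off the center.\<close>

lemma card_V: "card V = card C + card (block a) + (card labels - 1) * t"
proof -
  have "V = C \<union> (\<Union>b\<in>labels. block b)"
    using C_subset by (auto simp: block_def)
  then have "card V = card (C \<union> (\<Union>b\<in>labels. block b))"
    by simp
  also have "\<dots> = card C + card (\<Union>b\<in>labels. block b)"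
    by (intro card_Un_disjoint finite_UN_I finite_C finite_labels finite_block)
      (auto simp: block_def)
  finally show ?thesis
    using card_blocks[of labels] a_label by simp
qed

section \<open>Upper bound on path lengths\<close>

text \<open>Induction from the front of the path. A central first vertex raises the central count by
  one, which pays for a possible extra 1 in the bound for the tail. A noncentral one either shares
  its label with the next vertex or precedes a central vertex; in the latter case the tail needs no
  extra 1, so the 1 is free for the new label.\<close>

lemma card_labels_visited_le:
  assumes "distinct p" "successively adj p" "p \<noteq> []"
  shows "card (f ` (set p - C)) \<le> card (set p \<inter> C) + (if hd p \<in> C then 0 else 1)"
  using assms
proof (induction p rule: induct_list012)
  case (3 x y zs)
  let ?S = "set (y # zs)"
  have IH: "card (f ` (?S - C)) \<le> card (?S \<inter> C) + (if y \<in> C then 0 else 1)"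
    using 3 by simp
  have x: "x \<notin> ?S"
    using "3.prems" by simp
  show ?case
  proof (cases "x \<in> C")
    case True
    then have "set (x # y # zs) - C = ?S - C" "set (x # y # zs) \<inter> C = insert x (?S \<inter> C)"
      by auto
    moreover have "card (insert x (?S \<inter> C)) = Suc (card (?S \<inter> C))"
      using x by (intro card_insert_disjoint) auto
    ultimately show ?thesis
      using IH True by (auto split: if_splits)
  next
    case False
    then have eq: "f ` (set (x # y # zs) - C) = insert (f x) (f ` (?S - C))"
      "set (x # y # zs) \<inter> C = ?S \<inter> C"
      by auto
    show ?thesis
    proof (cases "y \<in> C")
      case True
      then show ?thesis
        using IH False card_insert_le_m1[of "Suc (card (?S \<inter> C))" "f ` (?S - C)" "f x"]
        unfolding eq by simp
    next
      case y: False
      then have "f x \<in> f ` (?S - C)"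
        using "3.prems" False by (auto simp: adj_def)
      then show ?thesis
        using IH False y unfolding eq by (simp add: insert_absorb)
    qed
  qed
qed (auto simp: insert_Diff_if)

lemma path_length_le:
  assumes "path p"
  shows "length p \<le> max_size (hd p)"
proof -
  define s where "s = card C - (if hd p \<in> C then 1 else 0)"
  define K where "K = f ` (set p - C)"
  have p: "p \<noteq> []" "set p \<subseteq> V" "distinct p" "successively adj p"
    using assms by (auto simp: path_def)
  have "card (set p \<inter> C) \<le> card C"
    by (intro card_mono finite_C) auto
  \<comment> \<open>For a central start the bound is \<open>card C\<close>, which equals
    \<open>Suc s\<close> only because \<open>C\<close> is nonempty.\<close>
  then have "card K \<le> Suc s"
    using card_labels_visited_le[OF p(3,4,1)] card_C_pos by (auto simp: s_def K_def split: if_splits)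
  have K: "K \<subseteq> labels"
    using p by (auto simp: K_def)
  have "card K \<le> card labels"
    by (intro card_mono finite_labels K)
  with \<open>card K \<le> Suc s\<close> have "card K - 1 \<le> min (card labels - 1) s"
    by linarith
  then have "(card K - 1) * t \<le> t * min (card labels - 1) s"
    by (metis mult.commute mult_le_mono2)
  \<comment> \<open>For paths that miss block \<open>a\<close>: one of the visited blocks is charged
    to block \<open>a\<close>, which is at least as large.\<close>
  moreover have "card K * t \<le> (card K - 1) * t + card (block a)"
    using card_large by (cases "card K") (auto simp: block_def)
  ultimately have "card (\<Union>b\<in>K. block b) \<le> card (block a) + t * min (card labels - 1) s"
    unfolding card_blocks[OF K] by (split if_split) linarith
  moreover have "set p \<subseteq> C \<union> (\<Union>b\<in>K. block b)"
    using p by (auto simp: K_def block_def)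
  then have "card (set p) \<le> card (C \<union> (\<Union>b\<in>K. block b))"
    using K finite_labels finite_subset
    by (intro card_mono finite_UnI finite_UN_I finite_C finite_block) blast
  ultimately show ?thesis
    using card_Un_le[of C "\<Union>b\<in>K. block b"] distinct_card[OF p(3)]
    by (simp add: max_size_def s_def)
qed

section \<open>Construction of longest paths\<close>

lemma successively_adj_block:
  assumes "set p \<subseteq> block b"
  shows "successively adj p"
proof (rule successively_if_sorted_wrt)
  have "sorted_wrt (\<lambda>x y. True) p"
    by (induction p) auto
  then show "sorted_wrt adj p"
    by (rule sorted_wrt_mono_rel[rotated]) (use assms in \<open>auto simp: adj_def block_def\<close>)
qed

text \<open>The path visits a central vertex, then a whole block, then the next central vertex, and
  so on; when the blocks run out, the remaining central vertices follow one another. The induction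
  on \<open>D\<close> varies \<open>v\<close> and \<open>K\<close>, since the tail starts at another
  central vertex and has one block fewer to cover.\<close>

lemma path_from_center_exists:
  assumes "D \<subseteq> C" "v \<in> D" "K \<subseteq> labels" "card K \<le> card D"
  obtains p where "path p" "hd p = v" "set p = D \<union> (\<Union>b\<in>K. block b)"
proof -
  have "finite D"
    using assms finite_C finite_subset by blast
  then have "\<exists>p. path p \<and> hd p = v \<and> set p = D \<union> (\<Union>b\<in>K. block b)"
    using assms
  proof (induction D arbitrary: v K rule: finite_remove_induct)
    case (remove D)
    have finK: "finite K"
      using remove.prems finite_labels finite_subset by blast
    \<comment> \<open>\<open>B\<close> is the stretch visited right after \<open>v\<close>: a whole
      block, or empty if no block is left.\<close>
    obtain B b K' where B: "B \<subseteq> block b" and K': "K' \<subseteq> K" "card K' \<le> card D - 1"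
      "B \<inter> (\<Union>b\<in>K'. block b) = {}" "(\<Union>b\<in>K. block b) = B \<union> (\<Union>b\<in>K'. block b)"
    proof (cases "K = {}")
      case False
      then obtain b where "b \<in> K"
        by blast
      then show ?thesis
        using remove.prems finK
        by (intro that[of "block b" b "K - {b}"]) (auto simp: block_def)
    qed (auto intro: that[of "{}" _ "{}"])
    have "finite B"
      using B finite_block finite_subset by blast
    then obtain q where q: "set q = B" "distinct q"
      using finite_distinct_list by blast
    have q': "successively adj q"
      using successively_adj_block B q by simp
    have v: "v \<in> C" "v \<in> V"
      using remove.prems C_subset by auto
    have BV: "B \<subseteq> V" "B \<inter> C = {}"
      using B by (auto simp: block_def)
    show ?case
    proof (cases "D = {v}")
      case True
      then have "K' = {}"
        using K' finK finite_subset by fastforce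
      then have "path (v # q) \<and> set (v # q) = D \<union> (\<Union>b\<in>K. block b)"
        using q q' v BV True K' by (auto simp: path_def successively_Cons adj_def)
      then show ?thesis
        by (intro exI[of _ "v # q"]) auto
    next
      case False
      then obtain w where w: "w \<in> D - {v}"
        using remove.prems by blast
      have card: "card K' \<le> card (D - {v})"
        using K' remove.prems remove.hyps by simp
      have labels: "K' \<subseteq> labels"
        using K' remove.prems by (meson subset_trans)
      have D: "v \<in> D" "D - {v} \<subseteq> C"
        using remove.prems by auto
      obtain p where
        p: "path p" "hd p = w" "set p = (D - {v}) \<union> (\<Union>b\<in>K'. block b)"
        using remove.IH[OF D w labels card] by blast
      have "v \<notin> block b" for b
        using v by (simp add: block_def)
      then have "v \<notin> set p" "v \<notin> set q"
        using p q B by auto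
      moreover have "set p \<inter> set q = {}"
        unfolding p(3) q(1) using BV(2) K'(3) D(2) by blast
      moreover have "w \<in> C"
        using w D(2) by blast
      \<comment> \<open>Both junctions hold because \<open>v\<close> and the head \<open>w\<close>
        of \<open>p\<close> are central.\<close>
      then have "successively adj (v # q @ p)"
        using p q' v by (simp add: path_def successively_Cons successively_append_iff adj_def)
      ultimately have "path (v # q @ p)"
        using p(1) q(2) v(2) BV(1) unfolding path_def q(1)[symmetric] by auto
      moreover have "set (v # q @ p) = D \<union> (\<Union>b\<in>K. block b)"
        using p(3) q(1) K'(4) D(1) by auto
      ultimately show ?thesis
        by (intro exI[of _ "v # q @ p"]) auto
    qed
  qed auto
  then show ?thesis
    using that by blast
qed

lemma card_center_blocks:
  assumes "K \<subseteq> labels" "a \<in> K" "card K = Suc k"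
  shows "card (C \<union> (\<Union>b\<in>K. block b)) = card C + card (block a) + t * k"
proof -
  have "card (C \<union> (\<Union>b\<in>K. block b)) = card C + card (\<Union>b\<in>K. block b)"
    using assms finite_labels finite_subset
    by (intro card_Un_disjoint finite_UN_I finite_C finite_block) (blast, auto simp: block_def)
  then show ?thesis
    using assms by (simp add: card_blocks)
qed

lemma labels_subset_exists:
  assumes "S \<subseteq> labels" "card S \<le> k" "k \<le> card labels"
  obtains K where "S \<subseteq> K" "K \<subseteq> labels" "card K = k"
  using exists_subset_between[of S k labels] assms finite_labels by blast

text \<open>From a central vertex, the alternating path is taken with all of \<open>C\<close>. From
  any other vertex, its own block is swept first, and an alternating path through \<open>C\<close>
  and the remaining chosen blocks follows.\<close>

lemma longest_path_exists:
  assumes "v \<in> V"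
  obtains p where "path p" "hd p = v" "length p = max_size v"
proof (cases "v \<in> C")
  case True
  define k where "k = min (card labels - 1) (card C - 1)"
  have "card labels > 0"
    using a_label finite_labels card_gt_0_iff by blast
  then have "Suc k \<le> card labels"
    by (simp add: k_def)
  then obtain K where K: "a \<in> K" "K \<subseteq> labels" "card K = Suc k"
    using labels_subset_exists[of "{a}" "Suc k"] a_label by (metis card_1_singleton_iff
        Suc_le_mono empty_subsetI insert_subset le0 One_nat_def)
  have "card K \<le> card C"
    using K card_C_pos by (simp add: k_def)
  then obtain p where p: "path p" "hd p = v" "set p = C \<union> (\<Union>b\<in>K. block b)"
    using path_from_center_exists[of C v K] True K by blast
  have "length p = max_size v"
    using p card_center_blocks[OF K(2,1,3)] True distinct_card[of p]
    by (simp add: path_def max_size_def k_def)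
  then show ?thesis
    using p that by blast
next
  case False
  define k where "k = min (card labels - 1) (card C)"
  have v: "v \<in> block (f v)" "f v \<in> labels"
    using assms False by (auto simp: block_def)
  have pos: "card labels > 0"
    using a_label finite_labels card_gt_0_iff by blast
  \<comment> \<open>The chosen blocks must include both that of \<open>v\<close> and block
    \<open>a\<close>. If these differ, \<open>k\<close> has to be positive, which holds as there are
    two labels and a central vertex.\<close>
  have "card {a, f v} \<le> Suc k"
  proof (cases "f v = a")
    case False
    then have "card {a, f v} \<le> card labels"
      using a_label v by (intro card_mono finite_labels) auto
    then show ?thesis
      using False card_C_pos by (auto simp: k_def)
  qed auto
  moreover have "Suc k \<le> card labels"
    using pos by (simp add: k_def)
  ultimately obtain K where K: "a \<in> K" "f v \<in> K" "K \<subseteq> labels" "card K = Suc k"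
    using labels_subset_exists[of "{a, f v}" "Suc k"] a_label v
    by (metis empty_subsetI insert_subset)
  obtain w where w: "w \<in> C"
    using C_nonempty by blast
  \<comment> \<open>The block of \<open>v\<close> needs no central vertex before it, so only
    \<open>k\<close> of the \<open>Suc k\<close> blocks count.\<close>
  have "card (K - {f v}) \<le> card C"
    using K by (simp add: k_def)
  then obtain p where p: "path p" "hd p = w" "set p = C \<union> (\<Union>b\<in>K - {f v}. block b)"
    using path_from_center_exists[of C w "K - {f v}"] K w by blast
  obtain q where q: "set q = block (f v) - {v}" "distinct q"
    using finite_distinct_list finite_block by (metis finite_Diff)
  have vq: "successively adj (v # q)"
    by (rule successively_adj_block[of _ "f v"]) (use q v in auto)
  have "block (f v) \<inter> block b = {}" if "b \<noteq> f v" for b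
    using that by (auto simp: block_def)
  moreover have "block (f v) \<inter> C = {}" "block (f v) \<subseteq> V"
    by (auto simp: block_def)
  ultimately have "path ((v # q) @ p)"
    using p q v w vq unfolding path_def successively_append_iff
    by (auto simp: adj_def)
  moreover have "set ((v # q) @ p) = C \<union> (\<Union>b\<in>K. block b)"
    using p q v K by auto
  ultimately have "length ((v # q) @ p) = max_size v"
    using card_center_blocks[OF K(3,1,4)] False distinct_card[of "(v # q) @ p"]
    by (simp add: path_def max_size_def k_def)
  with \<open>path ((v # q) @ p)\<close> show ?thesis
    using that[of "(v # q) @ p"] by simp
qed

text \<open>Any central vertex is a common neighbour. Connectedness ensures that each detour
  distance is the maximum of a nonempty set.\<close>

lemma path_between_exists:
  assumes "u \<in> V" "v \<in> V"
  shows "\<exists>p. path p \<and> hd p = u \<and> last p = v"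
proof -
  obtain w where w: "w \<in> C" "w \<in> V"
    using C_nonempty C_subset by blast
  consider "u = v" | "u \<noteq> v" "u = w \<or> v = w" | "u \<noteq> v" "u \<noteq> w" "v \<noteq> w"
    by blast
  then show ?thesis
  proof cases
    case 1
    then show ?thesis
      using assms by (intro exI[of _ "[u]"]) (auto simp: path_def)
  next
    case 2
    then show ?thesis
      using assms w by (intro exI[of _ "[u, v]"]) (auto simp: path_def adj_def)
  next
    case 3
    then show ?thesis
      using assms w by (intro exI[of _ "[u, w, v]"]) (auto simp: path_def adj_def)
  qed
qed

end

section \<open>Detour eccentricities\<close>

text \<open>Maximizing first over the paths to \<open>u\<close> and then over \<open>u\<close>
  amounts to maximizing over all paths from \<open>v\<close>; the endpoint of a longest such path
  attains the eccentricity.\<close>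

lemma detour_ecc_eqI:
  assumes "fin_digraph \<Gamma>" and v: "v \<in> verts \<Gamma>"
    and conn: "\<And>u. u \<in> verts \<Gamma> \<Longrightarrow> \<exists>p. vpath p \<Gamma> \<and> hd p = v \<and> last p = u"
    and upper: "\<And>p. vpath p \<Gamma> \<Longrightarrow> hd p = v \<Longrightarrow> vwalk_length p \<le> L"
    and q: "vpath q \<Gamma>" "hd q = v" "vwalk_length q = L"
  shows "detour_ecc \<Gamma> v = L"
proof -
  interpret fin_digraph \<Gamma> by fact
  let ?P = "\<lambda>u. {vwalk_length p | p. vpath p \<Gamma> \<and> hd p = v \<and> last p = u}"
  have fin: "finite (?P u)" for u
    by (rule finite_subset[of _ "vwalk_length ` {p. vpath p \<Gamma>}"]) (use vpaths_finite in auto)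
  have le: "detour_dist \<Gamma> v u \<le> L" if "u \<in> verts \<Gamma>" for u
    unfolding detour_dist_def using fin conn[OF that] upper by (subst Max_le_iff) auto
  have last: "last q \<in> verts \<Gamma>"
    using q by (auto simp: vpath_def vwalk_def)
  have "L \<le> detour_dist \<Gamma> v (last q)"
    unfolding detour_dist_def using q by (intro Max_ge fin) auto
  with le[OF last] have "detour_dist \<Gamma> v (last q) = L"
    by simp
  then show ?thesis
    unfolding detour_ecc_def using le last
    by (intro Max_eqI) auto
qed

lemma set_vwalk_arcs_subset_iff:
  "set (vwalk_arcs p) \<subseteq> R \<longleftrightarrow> successively (\<lambda>x y. (x, y) \<in> R) p"
  by (induction p rule: induct_list012) auto

text \<open>The inequality \<open>u \<noteq> v\<close> in the arcs is absorbed by distinctness of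
  the path.\<close>

lemma vpath_commuting_graph_iff:
  "vpath p (with_proj (commuting_graph H X)) \<longleftrightarrow>
    p \<noteq> [] \<and> set p \<subseteq> X \<and> distinct p \<and> successively (\<lambda>x y. x \<otimes>\<^bsub>H\<^esub> y = y \<otimes>\<^bsub>H\<^esub> x) p"
proof -
  have "successively (\<lambda>x y. (x, y) \<in> parcs (commuting_graph H X)) p \<longleftrightarrow>
      successively (\<lambda>x y. x \<otimes>\<^bsub>H\<^esub> y = y \<otimes>\<^bsub>H\<^esub> x) p"
    if "set p \<subseteq> X" "distinct p"
    using that by (induction p rule: induct_list012) (auto simp: commuting_graph_def)
  then show ?thesis
    by (auto simp: vpath_def vwalk_def set_vwalk_arcs_subset_iff commuting_graph_def)
qed

text \<open>The subtracted 1 converts a number of vertices into a number of edges.\<close>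

lemma (in clique_join) detour_ecc_commuting_graph:
  assumes comm: "\<And>x y. x \<in> V \<Longrightarrow> y \<in> V \<Longrightarrow> x \<otimes>\<^bsub>H\<^esub> y = y \<otimes>\<^bsub>H\<^esub> x \<longleftrightarrow> adj x y"
    and v: "v \<in> V"
  shows "detour_ecc (with_proj (commuting_graph H V)) v = max_size v - 1"
proof -
  let ?\<Gamma> = "with_proj (commuting_graph H V)"
  have vpath_iff: "vpath p ?\<Gamma> \<longleftrightarrow> path p" for p
  proof -
    have "successively (\<lambda>x y. x \<otimes>\<^bsub>H\<^esub> y = y \<otimes>\<^bsub>H\<^esub> x) p \<longleftrightarrow> successively adj p" if "set p \<subseteq> V"
      using that comm by (intro successively_cong) auto
    then show ?thesis
      by (auto simp: vpath_commuting_graph_iff path_def)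
  qed
  interpret pair_graph "commuting_graph H V"
    by (rule pair_graph_commuting_graph) (rule finite_V)
  obtain q where q: "path q" "hd q = v" "length q = max_size v"
    using longest_path_exists[OF v] .
  show ?thesis
  proof (rule detour_ecc_eqI)
    show "fin_digraph ?\<Gamma>"
      by unfold_locales
    show "vpath q ?\<Gamma>"
      using q vpath_iff by simp
    show "\<exists>p. vpath p ?\<Gamma> \<and> hd p = v \<and> last p = u" if "u \<in> verts ?\<Gamma>" for u
    proof -
      have "u \<in> V"
        using that by (simp add: commuting_graph_def)
      then show ?thesis
        unfolding vpath_iff using v by (intro path_between_exists)
    qed
    show "vwalk_length p \<le> max_size v - 1" if "vpath p ?\<Gamma>" "hd p = v" for p
      using that path_length_le[of p] by (simp add: vpath_iff diff_le_mono)
  qed (use q v in \<open>auto simp: commuting_graph_def\<close>)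
qed

section \<open>The generalized dihedral group\<close>

context comm_group
begin

abbreviation two_torsion :: "'a set" where
  "two_torsion \<equiv> {g \<in> carrier G. g [^] (2::nat) = \<one>}"

lemma square_eq: "g \<in> carrier G \<Longrightarrow> g [^] (2::nat) = g \<otimes> g"
  by (simp add: numeral_2_eq_2)

text \<open>Squaring is an endomorphism of an abelian group with kernel \<open>two_torsion\<close>,
  so its fibres are cosets of that kernel.\<close>

lemma square_fibre:
  assumes "g \<in> carrier G"
  shows "{h \<in> carrier G. h [^] (2::nat) = g [^] (2::nat)} = (\<lambda>x. x \<otimes> g) ` two_torsion"
proof (intro equalityI subsetI)
  fix h assume h: "h \<in> {h \<in> carrier G. h [^] (2::nat) = g [^] (2::nat)}"
  then have "(h \<otimes> inv g) [^] (2::nat) = \<one>"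
    using assms by (simp add: nat_pow_distrib nat_pow_inv)
  moreover have "h = (h \<otimes> inv g) \<otimes> g"
    using h assms by (simp add: m_assoc)
  ultimately show "h \<in> (\<lambda>x. x \<otimes> g) ` two_torsion"
    using h assms by (intro image_eqI[of _ _ "h \<otimes> inv g"]) auto
qed (use assms in \<open>auto simp: nat_pow_distrib\<close>)

lemma card_translate_two_torsion:
  "g \<in> carrier G \<Longrightarrow> card ((\<lambda>x. x \<otimes> g) ` two_torsion) = card two_torsion"
  by (intro card_image) (auto simp: inj_on_def)

lemma gen_dihedral_commute_iff:
  assumes "g \<in> carrier G" "h \<in> carrier G"
  shows "(g, 1) \<otimes>\<^bsub>gen_dihedral G\<^esub> (h, 1) = (h, 1) \<otimes>\<^bsub>gen_dihedral G\<^esub> (g, 1)"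
    and "(g, 1) \<otimes>\<^bsub>gen_dihedral G\<^esub> (h, -1) = (h, -1) \<otimes>\<^bsub>gen_dihedral G\<^esub> (g, 1) \<longleftrightarrow>
      g [^] (2::nat) = \<one>"
    and "(h, -1) \<otimes>\<^bsub>gen_dihedral G\<^esub> (g, 1) = (g, 1) \<otimes>\<^bsub>gen_dihedral G\<^esub> (h, -1) \<longleftrightarrow>
      g [^] (2::nat) = \<one>"
    and "(g, -1) \<otimes>\<^bsub>gen_dihedral G\<^esub> (h, -1) = (h, -1) \<otimes>\<^bsub>gen_dihedral G\<^esub> (g, -1) \<longleftrightarrow>
      g [^] (2::nat) = h [^] (2::nat)"
proof -
  show "(g, 1) \<otimes>\<^bsub>gen_dihedral G\<^esub> (h, 1) = (h, 1) \<otimes>\<^bsub>gen_dihedral G\<^esub> (g, 1)"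
    using assms by (simp add: gen_dihedral_def m_comm)
  \<comment> \<open>The two sides are the first components of the products of \<open>(g, 1)\<close>
    and \<open>(h, -1)\<close> in either order.\<close>
  have "g \<otimes> h = h \<otimes> inv g \<longleftrightarrow> g [^] (2::nat) = \<one>"
    using assms by (metis inv_closed m_comm right_cancel r_inv square_eq)
  then show "(g, 1) \<otimes>\<^bsub>gen_dihedral G\<^esub> (h, -1) = (h, -1) \<otimes>\<^bsub>gen_dihedral G\<^esub> (g, 1) \<longleftrightarrow>
      g [^] (2::nat) = \<one>"
    using assms by (simp add: gen_dihedral_def int_pow_neg)
  then show "(h, -1) \<otimes>\<^bsub>gen_dihedral G\<^esub> (g, 1) = (g, 1) \<otimes>\<^bsub>gen_dihedral G\<^esub> (h, -1) \<longleftrightarrow>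
      g [^] (2::nat) = \<one>"
    by metis
  have "g \<otimes> inv h = h \<otimes> inv g \<longleftrightarrow> g \<otimes> g = h \<otimes> h"
  proof -
    \<comment> \<open>Multiplication by \<open>g \<otimes> h\<close> clears both inverses and can be
      cancelled again.\<close>
    have "(g \<otimes> inv h) \<otimes> (g \<otimes> h) = g \<otimes> g" "(h \<otimes> inv g) \<otimes> (g \<otimes> h) = h \<otimes> h"
      using assms by (metis inv_closed l_inv m_assoc m_closed m_comm r_one)+
    then show ?thesis
      using assms by (metis inv_closed m_closed right_cancel)
  qed
  then show "(g, -1) \<otimes>\<^bsub>gen_dihedral G\<^esub> (h, -1) = (h, -1) \<otimes>\<^bsub>gen_dihedral G\<^esub> (g, -1) \<longleftrightarrow>
      g [^] (2::nat) = h [^] (2::nat)"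
    using assms by (simp add: gen_dihedral_def int_pow_neg square_eq)
qed

text \<open>If every square were trivial, inversion would be the identity and the generalized
  dihedral group would be abelian.\<close>

lemma not_two_torsion_exists:
  assumes "\<not> comm_group (gen_dihedral G)"
  obtains g where "g \<in> carrier G - two_torsion"
proof (cases "carrier G \<subseteq> two_torsion")
  case True
  have "comm_group (gen_dihedral G)"
  proof (rule group.group_comm_groupI)
    show "group (gen_dihedral G)"
      by (rule group_gen_dihedral) (rule comm_group_axioms)
    fix x y assume xy: "x \<in> carrier (gen_dihedral G)" "y \<in> carrier (gen_dihedral G)"
    then obtain g c h d where "x = (g, c)" "y = (h, d)" "g \<in> carrier G" "h \<in> carrier G"
      "c = 1 \<or> c = -1" "d = 1 \<or> d = -1"
      by (auto simp: gen_dihedral_def)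
    moreover from this have "g [^] (2::nat) = \<one>" "h [^] (2::nat) = \<one>"
      using True by blast+
    ultimately show "x \<otimes>\<^bsub>gen_dihedral G\<^esub> y = y \<otimes>\<^bsub>gen_dihedral G\<^esub> x"
      by (elim disjE) (simp_all add: gen_dihedral_commute_iff)
  qed
  then show ?thesis
    using assms by blast
qed (use that in blast)

section \<open>The cliques of rotations and reflections\<close>

text \<open>\<open>None\<close> names the clique of noncentral rotations, and the common square
  names a clique of reflections.\<close>

definition dihedral_label :: "'a \<times> int \<Rightarrow> 'a option" where
  "dihedral_label = (\<lambda>(g, c). if c = 1 then None else Some (g [^] (2::nat)))"

abbreviation dihedral_center :: "('a \<times> int) set" where
  "dihedral_center \<equiv> two_torsion \<times> {1}"

lemma rotation_block:
  "{x \<in> carrier (gen_dihedral G) - dihedral_center. dihedral_label x = None} =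
    (carrier G - two_torsion) \<times> {1}"
  by (auto simp: gen_dihedral_def dihedral_label_def)

lemma reflection_block:
  "{x \<in> carrier (gen_dihedral G) - dihedral_center. dihedral_label x = Some b} =
    {h \<in> carrier G. h [^] (2::nat) = b} \<times> {-1}"
  by (auto simp: gen_dihedral_def dihedral_label_def)

lemma clique_join_gen_dihedral:
  assumes fin: "finite (carrier G)" and "\<not> comm_group (gen_dihedral G)"
  shows "clique_join (carrier (gen_dihedral G)) dihedral_center dihedral_label None
    (card two_torsion)"
proof
  obtain g where g: "g \<in> carrier G - two_torsion"
    using not_two_torsion_exists assms by blast
  \<comment> \<open>A nontrivial coset of \<open>two_torsion\<close> lies in its complement, so the
    rotation clique is at least as large as each reflection clique.\<close>
  then have "(\<lambda>x. x \<otimes> g) ` two_torsion \<subseteq> carrier G - two_torsion"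
    by (auto simp: nat_pow_distrib)
  then have "card ((\<lambda>x. x \<otimes> g) ` two_torsion) \<le> card (carrier G - two_torsion)"
    by (intro card_mono finite_Diff fin)
  then have "card two_torsion \<le> card (carrier G - two_torsion)"
    using card_translate_two_torsion[of g] g by simp
  then show "card two_torsion \<le>
      card {x \<in> carrier (gen_dihedral G) - dihedral_center. dihedral_label x = None}"
    unfolding rotation_block by (simp add: card_cartesian_product)
  have "(g, 1) \<in> {x \<in> carrier (gen_dihedral G) - dihedral_center. dihedral_label x = None}"
    unfolding rotation_block using g by blast
  then show "None \<in> dihedral_label ` (carrier (gen_dihedral G) - dihedral_center)"
    by force
  show "card {x \<in> carrier (gen_dihedral G) - dihedral_center. dihedral_label x = b} =
      card two_torsion"
    if "b \<in> dihedral_label ` (carrier (gen_dihedral G) - dihedral_center)" "b \<noteq> None" for b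
  proof -
    obtain h c where "(h, c) \<in> carrier (gen_dihedral G)" "b = dihedral_label (h, c)"
      using \<open>b \<in> _\<close> by auto
    then have h: "h \<in> carrier G" and b: "b = Some (h [^] (2::nat))"
      using \<open>b \<noteq> None\<close> by (auto simp: gen_dihedral_def dihedral_label_def split: if_splits)
    show ?thesis
      unfolding b reflection_block card_cartesian_product square_fibre[OF h]
        card_translate_two_torsion[OF h] by simp
  qed
  have "\<one> \<in> two_torsion"
    by simp
  then show "dihedral_center \<noteq> {}"
    by blast
qed (use fin in \<open>auto simp: gen_dihedral_def\<close>)

lemma gen_dihedral_commute_iff_adj:
  assumes "finite (carrier G)" "\<not> comm_group (gen_dihedral G)"
    and "x \<in> carrier (gen_dihedral G)" "y \<in> carrier (gen_dihedral G)"
  shows "x \<otimes>\<^bsub>gen_dihedral G\<^esub> y = y \<otimes>\<^bsub>gen_dihedral G\<^esub> x \<longleftrightarrow>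
    clique_join.adj dihedral_center dihedral_label x y"
proof -
  obtain g c h d where "x = (g, c)" "y = (h, d)" "g \<in> carrier G" "h \<in> carrier G"
    "c = 1 \<or> c = -1" "d = 1 \<or> d = -1"
    using assms by (auto simp: gen_dihedral_def)
  then show ?thesis
    unfolding clique_join.adj_def[OF clique_join_gen_dihedral[OF assms(1,2)]]
    by (auto simp: gen_dihedral_commute_iff dihedral_label_def)
qed

text \<open>The witness \<open>m\<close> is the number of cliques of reflections.\<close>

lemma detour_ecc_gen_dihedral:
  assumes fin: "finite (carrier G)" and nonab: "\<not> comm_group (gen_dihedral G)"
  obtains m where "order G = m * card two_torsion"
    and "\<And>v. v \<in> carrier (gen_dihedral G) \<Longrightarrow>
      detour_ecc (with_proj (commuting_graph (gen_dihedral G) (carrier (gen_dihedral G)))) v =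
        order G + card two_torsion *
          min m (card two_torsion - (if v \<in> dihedral_center then 1 else 0)) - 1"
proof -
  interpret D: clique_join "carrier (gen_dihedral G)" dihedral_center dihedral_label None
    "card two_torsion"
    by (rule clique_join_gen_dihedral[OF assms])
  have le: "card two_torsion \<le> order G"
    using fin by (auto simp: order_def intro!: card_mono)
  have "card (D.block None) = order G - card two_torsion"
    unfolding D.block_def rotation_block order_def
    using fin by (simp add: card_cartesian_product card_Diff_subset)
  \<comment> \<open>The central vertices and the rotation clique together are exactly the rotations,
    which gives the summand \<open>order G\<close> of the eccentricity.\<close>
  then have block: "card two_torsion + card (D.block None) = order G"
    using le by simp
  have V: "card (carrier (gen_dihedral G)) = 2 * order G"
    by (simp add: gen_dihedral_def card_cartesian_product order_def)
  show ?thesis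
  proof (rule that)
    \<comment> \<open>The reflections, half of all vertices, split into cliques of equal size; the
      label \<open>None\<close> is left out.\<close>
    show "order G = (card D.labels - 1) * card two_torsion"
      using D.card_V V block by (simp add: card_cartesian_product)
    fix v assume "v \<in> carrier (gen_dihedral G)"
    then show "detour_ecc
        (with_proj (commuting_graph (gen_dihedral G) (carrier (gen_dihedral G)))) v =
      order G + card two_torsion *
        min (card D.labels - 1) (card two_torsion - (if v \<in> dihedral_center then 1 else 0)) - 1"
      using D.detour_ecc_commuting_graph[of "gen_dihedral G" v]
        gen_dihedral_commute_iff_adj[OF assms] block
      by (simp add: D.max_size_def card_cartesian_product)
  qed
qed

end

theorem theorem3p1:
  fixes G :: "('a, 'm) monoid_scheme"
    and n r :: nat
    and \<Gamma> :: "('a \<times> int) pair_pre_digraph"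
    and \<Omega>\<^sub>1 \<Omega>\<^sub>2 \<Omega>\<^sub>3 :: "('a \<times> int) set"
  assumes "comm_group G"
    and "finite (carrier G)"
    and "n = order G"
    and "\<not> comm_group (gen_dihedral G)"
    and "2 ^ r = card {g \<in> carrier G. g [^]\<^bsub>G\<^esub> (2::nat) = \<one>\<^bsub>G\<^esub>}"
    and "\<Gamma> = commuting_graph (gen_dihedral G) (carrier (gen_dihedral G))"
    and "\<Omega>\<^sub>1 = {(g, 1) | g. g \<in> carrier G \<and> g [^]\<^bsub>G\<^esub> (2::nat) = \<one>\<^bsub>G\<^esub>}"
    and "\<Omega>\<^sub>2 = {(g, 1) | g. g \<in> carrier G} - \<Omega>\<^sub>1"
    and "\<Omega>\<^sub>3 = {(g, -1) | g. g \<in> carrier G}"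
  shows "(\<forall>v\<in>\<Omega>\<^sub>1.
            (real n / 2 ^ r < 2 ^ r \<longrightarrow> detour_ecc (with_proj \<Gamma>) v = 2 * n - 1) \<and>
            (real n / 2 ^ r \<ge> 2 ^ r \<longrightarrow>
               detour_ecc (with_proj \<Gamma>) v = n + 2 ^ r * (2 ^ r - 1) - 1)) \<and>
         (\<forall>v\<in>\<Omega>\<^sub>2 \<union> \<Omega>\<^sub>3.
            (real n / 2 ^ r \<le> 2 ^ r \<longrightarrow> detour_ecc (with_proj \<Gamma>) v = 2 * n - 1) \<and>
            (real n / 2 ^ r > 2 ^ r \<longrightarrow>
               detour_ecc (with_proj \<Gamma>) v = n + 4 ^ r - 1))"
proof -
  interpret comm_group G by fact
  define T where "T = {g \<in> carrier G. g [^]\<^bsub>G\<^esub> (2::nat) = \<one>\<^bsub>G\<^esub>}"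
  have T: "card T = 2 ^ r"
    using assms(5) by (simp add: T_def)
  obtain m where m: "n = m * 2 ^ r"
    and ecc: "\<And>v. v \<in> carrier (gen_dihedral G) \<Longrightarrow> detour_ecc (with_proj \<Gamma>) v =
      n + 2 ^ r * min m (2 ^ r - (if v \<in> T \<times> {1} then 1 else 0)) - 1"
    using detour_ecc_gen_dihedral[OF assms(2,4), folded T_def assms(3,6), unfolded T] by blast
  \<comment> \<open>The case distinctions thus compare \<open>m\<close> with \<open>2 ^ r\<close>
    and decide each minimum. Where it equals \<open>m\<close>, the eccentricity is
    \<open>n + 2 ^ r * m - 1 = 2 * n - 1\<close>.\<close>
  have quot: "real n / 2 ^ r = real m"
    by (simp add: m)
  have \<Omega>: "\<Omega>\<^sub>1 = T \<times> {1}" "\<Omega>\<^sub>1 \<subseteq> carrier (gen_dihedral G)"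
    "\<Omega>\<^sub>2 \<union> \<Omega>\<^sub>3 \<subseteq> carrier (gen_dihedral G)" "(\<Omega>\<^sub>2 \<union> \<Omega>\<^sub>3) \<inter> \<Omega>\<^sub>1 = {}"
    unfolding assms(7-9) by (auto simp: T_def gen_dihedral_def)
  have real_pow: "real m < 2 ^ r \<longleftrightarrow> m < 2 ^ r" "real m \<le> 2 ^ r \<longleftrightarrow> m \<le> 2 ^ r"
    "2 ^ r \<le> real m \<longleftrightarrow> 2 ^ r \<le> m" "2 ^ r < real m \<longleftrightarrow> 2 ^ r < m"
    by (metis of_nat_less_iff of_nat_le_iff of_nat_numeral of_nat_power)+
  have four: "(4::nat) ^ r = 2 ^ r * 2 ^ r"
    by (simp flip: power_mult_distrib)
  have ecc1: "detour_ecc (with_proj \<Gamma>) v = n + 2 ^ r * min m (2 ^ r - 1) - 1" if "v \<in> \<Omega>\<^sub>1" for v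
    using that ecc[of v] \<Omega> by auto
  have ecc2: "detour_ecc (with_proj \<Gamma>) v = n + 2 ^ r * min m (2 ^ r) - 1" if "v \<in> \<Omega>\<^sub>2 \<union> \<Omega>\<^sub>3" for v
  proof -
    have "v \<notin> T \<times> {1}" "v \<in> carrier (gen_dihedral G)"
      using that \<Omega> by blast+
    then show ?thesis
      using ecc[of v] by simp
  qed
  have min1: "m < 2 ^ r \<Longrightarrow> min m (2 ^ r - 1) = m" "2 ^ r \<le> m \<Longrightarrow> min m (2 ^ r - 1) = 2 ^ r - 1"
    by auto
  show ?thesis
    unfolding quot real_pow
    using ecc1 ecc2 min1 by (simp add: m four min_def mult.commute mult_2)
qed

end
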